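(* Let $\Omega$ be an $R$-domain of degree $\ge2$. Then the matching problem for $\Gamma=\partial\Omega$ has only trivial solutions, i.e. if $(f,g)$ is a solution then $f$ and $g$ are constant (hence $f\equiv0$, $g\equiv0$).
   Context: An $R$-domain is a simply connected plane domain $\Omega=\varphi(\mathbb D)$, where $\mathbb D$ is the open unit disk and $\varphi$ is a rational function univalent on a neighborhood of $\overline{\mathbb D}$; its degree is the degree of $\varphi=p/q$ ($p,q$ coprime polynomials), namely $\max(\deg p,\deg q)$. For a Jordan curve $\Gamma$ with interior domain $\Omega$ and exterior domain $\Omega':=\widehat{\mathbb C}\setminus\overline\Omega$, a solution of the matching problem is a pair $(f,g)$ with: $f$ holomorphic in $\Omega$ and continuous on $\overline\Omega$; $g$ holomorphic in $\Omega'$, continuous on $\overline{\Omega'}$, with $g(\infty)=0$; and $f(\zeta)=\overline{g(\zeta)}$ for all $\zeta\in\Gamma$. It is non-trivial if $f,g$ are non-constant. *)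

theory Defs
  imports "HOL-Complex_Analysis.Complex_Analysis" "HOL-Computational_Algebra.Computational_Algebra"
begin

definition rat_fun :: "complex poly \<Rightarrow> complex poly \<Rightarrow> complex \<Rightarrow> complex" where
  "rat_fun p q = (\<lambda>z. poly p z / poly q z)"

text \<open>p/q (p, q coprime) is univalent (and pole-free) on an open neighbourhood of the
  closed unit disk, so that phi(D) is a (bounded) R-domain.\<close>
definition R_domain_param :: "complex poly \<Rightarrow> complex poly \<Rightarrow> bool" where
  "R_domain_param p q \<longleftrightarrow> coprime p q \<and>
     (\<exists>U. open U \<and> cball 0 1 \<subseteq> U \<and> (\<forall>z\<in>U. poly q z \<noteq> 0) \<and> inj_on (rat_fun p q) U)"

definition rat_degree :: "complex poly \<Rightarrow> complex poly \<Rightarrow> nat" where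
  "rat_degree p q = max (degree p) (degree q)"

text \<open>Solutions of the matching problem for the boundary of a bounded Jordan domain \<Omega>.
  The exterior domain is the complement of closure \<Omega> in the Riemann sphere; g is given
  on the finite part, holomorphic at infinity with g(\<infinity>) = 0 is expressed by g \<rightarrow> 0 at infinity
  (removable singularity).\<close>
definition matching_solution :: "complex set \<Rightarrow> (complex \<Rightarrow> complex) \<Rightarrow> (complex \<Rightarrow> complex) \<Rightarrow> bool" where
  "matching_solution \<Omega> f g \<longleftrightarrow>
     f holomorphic_on \<Omega> \<and> continuous_on (closure \<Omega>) f \<and>
     g holomorphic_on (- closure \<Omega>) \<and> continuous_on (- \<Omega>) g \<and> (g \<longlongrightarrow> 0) at_infinity \<and>
     (\<forall>\<zeta>\<in>frontier \<Omega>. f \<zeta> = cnj (g \<zeta>))"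

end

theory Submission
  imports Defs
begin

text \<open>
  Reflect \<open>f \<circ> \<phi>\<close> in the unit circle: \<open>H u = cnj (f (\<phi> (cnj u)))\<close> is holomorphic in the disk and
  \<open>H (1/z) = g (\<phi> z)\<close> on \<open>|z| = 1\<close>. For \<open>w \<in> \<Omega>\<close> the integral of \<open>g (\<phi> z) \<phi>'(z) / (\<phi> z - w)\<close> over the
  circle is 0 by Cauchy's theorem in the exterior domain. On the other hand
  \<open>\<phi>' / (\<phi> - w)\<close> is the difference of the logarithmic derivatives of \<open>p - w q\<close> and \<open>q\<close>, so the integral
  is a sum of values of \<open>H\<close> over the roots outside the disk. Hence the sum of \<open>H (1/z)\<close>
  over the solutions of \<open>\<phi> z = w\<close> with \<open>|z| > 1\<close> (including infinity) equals the sum over the poles of \<open>\<phi>\<close>,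
  independently of \<open>w\<close>. The same holds for \<open>S \<circ> H\<close> and \<open>S \<circ> g\<close> for each polynomial \<open>S\<close> with \<open>S 0 = 0\<close>,
  which forces \<open>H\<close> to take only finitely many values on the set where \<open>|u| < 1\<close> and \<open>\<phi> (1/u) \<in> \<Omega>\<close>.
  This set is nonempty because the degree is at least 2, so \<open>H\<close> is constant.
\<close>

subsection \<open>Functions holomorphic near infinity\<close>

text \<open>In the coordinate \<open>v = 1 / (\<zeta> - c)\<close> infinity becomes 0, which has to be added by hand since
  \<open>inverse 0 = 0\<close>.\<close>
definition inverted_exterior :: "complex set \<Rightarrow> complex \<Rightarrow> complex set" where
  "inverted_exterior K c = insert 0 {v. c + inverse v \<notin> K}"

definition inverted_fun :: "(complex \<Rightarrow> complex) \<Rightarrow> complex \<Rightarrow> complex \<Rightarrow> complex" where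
  "inverted_fun g c = (\<lambda>v. if v = 0 then 0 else g (c + inverse v))"

lemma zero_interior_inverted_exterior:
  assumes "bounded K"
  obtains e where "e > 0" "ball 0 e \<subseteq> inverted_exterior K c"
proof -
  obtain B where B: "B > 0" "K \<subseteq> cball c B"
    using bounded_subset_ballD[OF assms, of c] ball_subset_cball by blast
  have "ball 0 (inverse B) \<subseteq> inverted_exterior K c"
  proof
    fix v :: complex assume v: "v \<in> ball 0 (inverse B)"
    show "v \<in> inverted_exterior K c"
    proof (cases "v = 0")
      case False
      have "norm (inverse v) > B"
        using v False B(1) by (simp add: norm_inverse norm_divide field_simps)
      hence "c + inverse v \<notin> K" using B(2) by (auto simp: dist_norm)
      thus ?thesis by (simp add: inverted_exterior_def)
    qed (simp add: inverted_exterior_def)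
  qed
  thus ?thesis using B(1) that[of "inverse B"] by simp
qed

text \<open>The ball about 0 is treated apart: \<open>inverse 0 = 0\<close> makes the inversion
  discontinuous at 0, so the preimage argument covers only nonzero \<open>v\<close>.\<close>

lemma open_inverted_exterior:
  assumes "compact K"
  shows "open (inverted_exterior K c)"
proof -
  obtain e where e: "e > 0" "ball 0 e \<subseteq> inverted_exterior K c"
    using zero_interior_inverted_exterior compact_imp_bounded[OF assms] by blast
  have "open (- {0} \<inter> (\<lambda>v. c + inverse v) -` (- K))"
    using assms by (intro continuous_open_preimage continuous_intros) (auto simp: compact_imp_closed)
  moreover have "inverted_exterior K c = ball 0 e \<union> (- {0} \<inter> (\<lambda>v. c + inverse v) -` (- K))"
    using e by (auto simp: inverted_exterior_def)
  ultimately show ?thesis by (metis open_Un open_ball)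
qed

text \<open>A small ball about \<open>c\<close> inside \<open>K\<close> excludes every large
  \<open>v\<close>. Boundedness is what admits the maximum principle in the inverted
  coordinate.\<close>

lemma bounded_inverted_exterior:
  assumes "c \<in> interior K"
  shows "bounded (inverted_exterior K c)"
proof -
  obtain e where e: "e > 0" "ball c e \<subseteq> K"
    using assms mem_interior by blast
  have "inverted_exterior K c \<subseteq> cball 0 (inverse e)"
  proof
    fix v assume v: "v \<in> inverted_exterior K c"
    show "v \<in> cball 0 (inverse e)"
    proof (cases "v = 0")
      case False
      hence "c + inverse v \<notin> ball c e" using v e by (auto simp: inverted_exterior_def)
      hence "inverse (norm v) \<ge> e" by (simp add: dist_norm norm_inverse)
      thus ?thesis using False e(1) by (simp add: field_simps)
    qed (use e in auto)
  qed
  thus ?thesis using bounded_cball bounded_subset by blast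
qed

lemma inverted_fun_tendsto_0:
  assumes "(g \<longlongrightarrow> 0) at_infinity"
  shows "(inverted_fun g c \<longlongrightarrow> 0) (at 0)"
proof -
  have "filterlim (\<lambda>v::complex. c + inverse v) at_infinity (at 0)"
    by (intro tendsto_add_filterlim_at_infinity[OF tendsto_const filterlim_inverse_at_infinity])
  hence "((\<lambda>v. g (c + inverse v)) \<longlongrightarrow> 0) (at 0)"
    by (rule filterlim_compose[OF assms])
  moreover have "\<forall>\<^sub>F v in at 0. g (c + inverse v) = inverted_fun g c v"
    by (auto simp: inverted_fun_def eventually_at_filter)
  ultimately show ?thesis by (rule Lim_transform_eventually)
qed

text \<open>\<open>A\<close> is arbitrary, so that both compact sets and open domains are covered;
  for an open domain the inverted exterior includes the boundary.\<close>

lemma continuous_on_inverted_fun: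
  assumes "continuous_on (- A) g" "(g \<longlongrightarrow> 0) at_infinity"
  shows "continuous_on (inverted_exterior A c) (inverted_fun g c)"
  unfolding continuous_on_def
proof
  fix v assume v: "v \<in> inverted_exterior A c"
  show "(inverted_fun g c \<longlongrightarrow> inverted_fun g c v) (at v within inverted_exterior A c)"
  proof (cases "v = 0")
    case True
    thus ?thesis using inverted_fun_tendsto_0[OF assms(2), of c]
      by (auto simp: inverted_fun_def intro: tendsto_within_subset)
  next
    case False
    let ?S = "inverted_exterior A c"
    have "continuous_on (?S - {0}) (\<lambda>v. g (c + inverse v))"
      by (intro continuous_on_compose2[OF assms(1)] continuous_intros) (auto simp: inverted_exterior_def)
    hence "((\<lambda>v. g (c + inverse v)) \<longlongrightarrow> g (c + inverse v)) (at v within (?S - {0}))"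
      using v False by (simp add: continuous_on_def)
    moreover have "at v within (?S - {0}) = at v within ?S"
      using False by (intro at_within_nhd[of _ "- {0}"]) auto
    moreover have "\<forall>\<^sub>F x in at v within ?S. g (c + inverse x) = inverted_fun g c x"
    proof -
      have "\<forall>\<^sub>F x in nhds v. x \<in> - {0}"
        using False by (intro eventually_nhds_in_open) auto
      thus ?thesis unfolding eventually_at_filter
        by (rule eventually_mono) (auto simp: inverted_fun_def)
    qed
    ultimately show ?thesis using False
      by (auto simp: inverted_fun_def intro: Lim_transform_eventually)
  qed
qed

text \<open>Away from 0 this is composition with the inversion; at 0 the singularity is removable
  because the decay of \<open>g\<close> gives continuity there.\<close>

lemma holomorphic_on_inverted_fun:
  assumes "compact K" "g holomorphic_on - K" "(g \<longlongrightarrow> 0) at_infinity"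
  shows "inverted_fun g c holomorphic_on inverted_exterior K c"
proof (rule no_isolated_singularity[where K = "{0}"])
  have "(\<lambda>v. g (c + inverse v)) holomorphic_on (inverted_exterior K c - {0})"
    by (intro holomorphic_on_compose_gen[OF _ assms(2), unfolded o_def] holomorphic_intros)
       (auto simp: inverted_exterior_def)
  thus "inverted_fun g c holomorphic_on inverted_exterior K c - {0}"
    by (rule holomorphic_transform) (auto simp: inverted_fun_def)
  show "continuous_on (inverted_exterior K c) (inverted_fun g c)"
    using assms by (intro continuous_on_inverted_fun holomorphic_on_imp_continuous_on)
qed (use assms in \<open>auto intro: open_inverted_exterior\<close>)

text \<open>Inversion at \<open>c\<close> turns \<open>K - {c}\<close> into a connected unbounded set, around whose points
  the inverted path has winding number 0.\<close>
lemma Cauchy_theorem_exterior: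
  assumes K: "compact K" "c islimpt K" "connected (K - {c})"
    and g: "g holomorphic_on - K" "(g \<longlongrightarrow> 0) at_infinity"
    and \<gamma>: "valid_path \<gamma>" "pathfinish \<gamma> = pathstart \<gamma>" "path_image \<gamma> \<subseteq> - K"
  shows "contour_integral \<gamma> (\<lambda>\<zeta>. g \<zeta> / (\<zeta> - c)) = 0"
proof -
  define V where "V = inverted_exterior K c"
  define G where "G = inverted_fun g c"
  \<comment> \<open>Under \<open>v = 1 / (\<zeta> - c)\<close> the form d\<zeta>/(\<zeta> - c)
    becomes -dv/v, so the integrand is \<open>- k\<close>. As \<open>G 0 = 0\<close>, the quotient
    \<open>G v / v\<close> extends holomorphically across 0 by the derivative.\<close>
  define k where "k = (\<lambda>v. if v = 0 then deriv G 0 else G v / v)"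
  define j where "j = (\<lambda>\<zeta>. inverse (\<zeta> - c))"
  have cK: "c \<in> K" using K closed_limpt compact_imp_closed by blast
  have V: "open V" unfolding V_def using K(1) by (rule open_inverted_exterior)
  have G: "G holomorphic_on V" unfolding G_def V_def using K(1) g by (rule holomorphic_on_inverted_fun)
  have k: "k holomorphic_on V"
    by (rule pole_theorem_open_0[OF G V, of 0]) (auto simp: k_def G_def inverted_fun_def)
  have j: "j holomorphic_on - {c}" unfolding j_def by (auto intro!: holomorphic_intros)
  have \<gamma>c: "path_image \<gamma> \<subseteq> - {c}" using \<gamma> cK by auto
  have vp: "valid_path (j \<circ> \<gamma>)"
    using valid_path_compose_holomorphic[OF \<gamma>(1) j _ \<gamma>c] by (simp add: open_Compl)
  have loop: "pathfinish (j \<circ> \<gamma>) = pathstart (j \<circ> \<gamma>)"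
    using \<gamma>(2) by (simp add: pathfinish_def pathstart_def)
  have im: "path_image (j \<circ> \<gamma>) = j ` path_image \<gamma>" by (simp add: path_image_compose)
  have imV: "path_image (j \<circ> \<gamma>) \<subseteq> V"
    unfolding im using \<gamma>(3) cK by (auto simp: V_def inverted_exterior_def j_def)
  have T: "- V = j ` (K - {c})"
  proof
    show "- V \<subseteq> j ` (K - {c})"
    proof
      fix v assume "v \<in> - V"
      hence "v \<noteq> 0" "c + inverse v \<in> K" by (auto simp: V_def inverted_exterior_def)
      thus "v \<in> j ` (K - {c})"
        by (intro image_eqI[of _ _ "c + inverse v"]) (auto simp: j_def)
    qed
  qed (auto simp: V_def inverted_exterior_def j_def)
  have "continuous_on (K - {c}) j" unfolding j_def by (intro continuous_intros) auto
  hence "connected (- V)" using K(3) unfolding T by (rule connected_continuous_image)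
  moreover have "- V \<inter> path_image (j \<circ> \<gamma>) = {}" using imV by blast
  ultimately have "winding_number (j \<circ> \<gamma>) constant_on - V"
    by (rule winding_number_constant[OF valid_path_imp_path[OF vp] loop])
  then obtain m where m: "\<And>v. v \<in> - V \<Longrightarrow> winding_number (j \<circ> \<gamma>) v = m"
    unfolding constant_on_def by blast
  obtain B where B: "\<And>v. B \<le> cmod v \<Longrightarrow> winding_number (j \<circ> \<gamma>) v = 0"
    using winding_number_zero_at_infinity[OF valid_path_imp_path[OF vp] loop] by blast
  \<comment> \<open>The maximum with 1 makes \<open>inverse D\<close> a positive distance. A point
    of \<open>K\<close> closer than that to \<open>c\<close> inverts to norm above \<open>D\<close>,
    where the winding number is 0; this determines the constant \<open>m\<close>.\<close>
  define D where "D = max B 1"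
  have D: "D > 0" "B \<le> D" by (auto simp: D_def)
  then obtain a where a: "a \<in> K" "a \<noteq> c" "dist a c < inverse D"
    using K(2) unfolding islimpt_approachable by (meson inverse_positive_iff_positive)
  have "D < norm (j a)" using a D(1)
    by (simp add: j_def norm_inverse norm_divide dist_norm field_simps)
  hence "m = 0" using B[of "j a"] m[of "j a"] a D(2) by (auto simp: T)
  hence "(k has_contour_integral 0) (j \<circ> \<gamma>)"
    using Cauchy_theorem_global[OF V k vp loop imV] m by auto
  hence "0 = contour_integral (j \<circ> \<gamma>) k" by (simp add: contour_integral_unique)
  also have "\<dots> = contour_integral \<gamma> (\<lambda>w. deriv j w * k (j w))"
    using \<gamma>c \<gamma>(1) j by (intro contour_integral_comp_analyticW[where s = "- {c}"]) (auto simp: analytic_on_open open_Compl)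
  also have "\<dots> = contour_integral \<gamma> (\<lambda>\<zeta>. - (g \<zeta> / (\<zeta> - c)))"
  proof (rule contour_integral_eq)
    fix \<zeta> assume "\<zeta> \<in> path_image \<gamma>"
    hence ne: "\<zeta> - c \<noteq> 0" using \<gamma>c by auto
    have "(j has_field_derivative - inverse ((\<zeta> - c)^2)) (at \<zeta>)"
      unfolding j_def using ne by (auto intro!: derivative_eq_intros simp: power2_eq_square)
    hence "deriv j \<zeta> = - inverse ((\<zeta> - c)^2)" by (rule DERIV_imp_deriv)
    thus "deriv j \<zeta> * k (j \<zeta>) = - (g \<zeta> / (\<zeta> - c))"
      using ne by (simp add: k_def j_def G_def inverted_fun_def divide_inverse power2_eq_square)
  qed
  also have "\<dots> = - contour_integral \<gamma> (\<lambda>\<zeta>. g \<zeta> / (\<zeta> - c))"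
    by (simp add: contour_integral_neg)
  finally show ?thesis by simp
qed

text \<open>The maximum principle in the inverted coordinate.\<close>
lemma exterior_constant_boundary_imp_zero:
  assumes A: "bounded A" "open A" "c \<in> A"
    and g: "g holomorphic_on - closure A" "continuous_on (- A) g" "(g \<longlongrightarrow> 0) at_infinity"
    and \<kappa>: "\<And>\<zeta>. \<zeta> \<in> frontier A \<Longrightarrow> g \<zeta> = \<kappa>"
  shows "\<kappa> = 0" and "\<zeta> \<notin> A \<Longrightarrow> g \<zeta> = 0"
proof -
  define V where "V = inverted_exterior (closure A) c"
  define V' where "V' = inverted_exterior A c"
  define G where "G = inverted_fun g c"
  have V: "open V" "bounded V"
    using A closure_subset[of A]
    by (auto simp: V_def open_inverted_exterior intro!: bounded_inverted_exterior interiorI[of A])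
  have "- V' = - {0} \<inter> (\<lambda>v. c + inverse v) -` A"
    by (auto simp: V'_def inverted_exterior_def)
  moreover have "open (- {0} \<inter> (\<lambda>v. c + inverse v) -` A)"
    using A by (intro continuous_open_preimage continuous_intros) auto
  ultimately have "closed V'" by (simp add: closed_def)
  moreover have "V \<subseteq> V'" using closure_subset[of A] by (auto simp: V_def V'_def inverted_exterior_def)
  ultimately have cl: "closure V \<subseteq> V'" by (simp add: closure_minimal)
  have G: "G holomorphic_on V" "continuous_on V' G"
    using A g by (auto simp: G_def V_def V'_def intro!: holomorphic_on_inverted_fun continuous_on_inverted_fun)
  have bd: "G v = \<kappa>" if "v \<in> frontier V" for v
  proof -
    have v: "v \<in> V'" "v \<notin> V" using that V cl by (auto simp: frontier_def interior_open)
    hence "v \<noteq> 0" "c + inverse v \<in> frontier A"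
      using A by (auto simp: V'_def V_def inverted_exterior_def frontier_def interior_open)
    thus ?thesis using \<kappa> by (simp add: G_def inverted_fun_def)
  qed
  have *: "G v = \<kappa>" if "v \<in> V" for v
  proof -
    have "norm (G v - \<kappa>) \<le> 0"
      by (rule maximum_modulus_frontier[of "\<lambda>v. G v - \<kappa>" V])
         (use G V cl bd that in \<open>auto simp: interior_open intro!: holomorphic_intros continuous_intros
            intro: continuous_on_subset\<close>)
    thus ?thesis by simp
  qed
  \<comment> \<open>The point 0 stands for infinity, where \<open>G\<close> is 0 by definition, so
    the boundary constant has to be 0.\<close>
  have "G 0 = \<kappa>" by (rule *) (auto simp: V_def inverted_exterior_def)
  thus \<kappa>0: "\<kappa> = 0" by (simp add: G_def inverted_fun_def)
  show "g \<zeta> = 0" if "\<zeta> \<notin> A"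
  proof (cases "\<zeta> \<in> closure A")
    case True
    thus ?thesis using that A \<kappa> \<kappa>0 by (auto simp: frontier_def interior_open)
  next
    case False
    have "\<zeta> \<noteq> c" using that A by auto
    have "G (inverse (\<zeta> - c)) = \<kappa>" by (rule *) (use False in \<open>auto simp: V_def inverted_exterior_def\<close>)
    thus ?thesis using \<open>\<zeta> \<noteq> c\<close> \<kappa>0 by (simp add: G_def inverted_fun_def)
  qed
qed

subsection \<open>Logarithmic derivatives on the unit circle\<close>

text \<open>For \<open>norm a \<noteq> 1\<close> this is 1/(2 pi i) times the integral of
  \<open>H (1/z) / (z - a)\<close> over the unit circle. The term \<open>H 0\<close> is the
  contribution of infinity.\<close>

definition reflected_weight :: "(complex \<Rightarrow> complex) \<Rightarrow> complex \<Rightarrow> complex" where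
  "reflected_weight H a = H 0 - (if norm a > 1 then H (inverse a) else 0)"

text \<open>Inversion reverses the orientation of the circle and has derivative -1/u^2; the two
  signs cancel.\<close>

lemma contour_integral_unit_circle_inverse:
  "contour_integral (circlepath 0 1) k = contour_integral (circlepath 0 1) (\<lambda>u. k (inverse u) / u^2)"
proof -
  have rev: "inverse \<circ> circlepath 0 1 = reversepath (circlepath 0 1)"
    by (auto simp: fun_eq_iff circlepath_def reversepath_def part_circlepath_def linepath_def
          scaleR_conv_of_real exp_diff exp_minus algebra_simps inverse_eq_divide)
  have "- contour_integral (circlepath 0 1) k = contour_integral (inverse \<circ> circlepath 0 1) k"
    unfolding rev by (simp add: contour_integral_reversepath)
  also have "\<dots> = contour_integral (circlepath 0 1) (\<lambda>w. deriv inverse w * k (inverse w))"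
    by (rule contour_integral_comp_analyticW[where s = "- {0}"])
       (auto simp: analytic_on_open open_Compl intro!: holomorphic_intros)
  also have "\<dots> = contour_integral (circlepath 0 1) (\<lambda>u. - (k (inverse u) / u^2))"
  proof (rule contour_integral_eq)
    fix u :: complex assume "u \<in> path_image (circlepath 0 1)"
    hence "u \<noteq> 0" by auto
    hence "(inverse has_field_derivative - (inverse u ^ 2)) (at u)"
      using DERIV_inverse[of u] by (simp add: numeral_2_eq_2)
    hence "deriv inverse u = - (inverse u ^ 2)" by (rule DERIV_imp_deriv)
    thus "deriv inverse u * k (inverse u) = - (k (inverse u) / u^2)"
      by (simp add: field_simps)
  qed
  also have "\<dots> = - contour_integral (circlepath 0 1) (\<lambda>u. k (inverse u) / u^2)"
    by (simp add: contour_integral_neg)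
  finally show ?thesis by simp
qed

lemma continuous_on_sphere_inverse:
  assumes "continuous_on (cball 0 1) H"
  shows "continuous_on (sphere 0 1) (\<lambda>z::complex. H (inverse z))"
  by (intro continuous_on_compose2[OF assms] continuous_intros) (auto simp: norm_inverse)

text \<open>After inversion the integrand is H(u)/(u (1 - a u)) = H(u)/u - H(u)/(u - 1/a). Cauchy's
  formula gives \<open>H 0\<close> for the first term, and for the second
  \<open>H (inverse a)\<close> or 0 according to whether 1/a lies inside the disk.\<close>

lemma has_contour_integral_reflected_Cauchy:
  assumes H: "continuous_on (cball 0 1) H" "H holomorphic_on ball 0 1" and a: "norm a \<noteq> 1"
  shows "((\<lambda>z. H (inverse z) / (z - a)) has_contour_integral
           2 * of_real pi * \<i> * reflected_weight H a) (circlepath 0 1)"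
proof -
  let ?k = "\<lambda>z. H (inverse z) / (z - a)" and ?C = "circlepath 0 1"
  have "continuous_on (path_image ?C) ?k"
    using a by (auto intro!: continuous_intros continuous_on_sphere_inverse H)
  hence int: "?k contour_integrable_on ?C"
    by (intro contour_integrable_continuous_circlepath) auto
  have H0: "((\<lambda>u. H u / (u - 0)) has_contour_integral 2 * of_real pi * \<i> * H 0) ?C"
    using Cauchy_integral_circlepath[OF H, of 0] by simp
  have "((\<lambda>u. ?k (inverse u) / u^2) has_contour_integral 2 * of_real pi * \<i> * reflected_weight H a) ?C"
  \<comment> \<open>For \<open>a = 0\<close> the second partial fraction is absent, and the default
    value \<open>inverse 0 = 0\<close> would give a wrong one.\<close>
  proof (cases "a = 0")
    case True
    have "reflected_weight H a = H 0" by (simp add: True reflected_weight_def)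
    thus ?thesis
      by (simp only:, intro has_contour_integral_eq[OF H0])
         (auto simp: True field_simps power2_eq_square)
  next
    case False
    have Ha: "((\<lambda>u. H u / (u - inverse a)) has_contour_integral
        2 * of_real pi * \<i> * (if norm a > 1 then H (inverse a) else 0)) ?C"
    proof (cases "norm a > 1")
      case True
      hence "norm (inverse a - 0) < 1" by (simp add: norm_inverse inverse_less_1_iff)
      thus ?thesis using Cauchy_integral_circlepath[OF H, of "inverse a"] True by simp
    next
      case na: False
      hence ia: "norm (inverse a) > 1" using a False by (simp add: norm_inverse one_less_inverse)
      have "((\<lambda>u. H u / (u - inverse a)) has_contour_integral 0) ?C"
      proof (rule Cauchy_theorem_disc[where K = "{}" and a = 0 and e = 1])
        show "continuous_on (cball 0 1) (\<lambda>u. H u / (u - inverse a))"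
          using ia by (auto intro!: continuous_intros H)
        have "(\<lambda>u. H u / (u - inverse a)) holomorphic_on ball 0 1"
          using ia by (auto intro!: holomorphic_intros H)
        thus "(\<lambda>u. H u / (u - inverse a)) field_differentiable at x" if "x \<in> ball 0 1 - {}" for x
          using that by (auto simp: holomorphic_on_imp_differentiable_at)
      qed auto
      thus ?thesis using na by simp
    qed
    show ?thesis unfolding reflected_weight_def right_diff_distrib
    proof (rule has_contour_integral_eq[OF has_contour_integral_diff[OF H0 Ha]])
      fix u assume "u \<in> path_image ?C"
      hence u: "norm u = 1" "u \<noteq> 0" by auto
      have "a * u \<noteq> 1" using a u by (metis mult.right_neutral norm_mult norm_one)
      hence "inverse u \<noteq> a" "u \<noteq> inverse a" using u False by (auto simp: field_simps)
      thus "H u / (u - 0) - H u / (u - inverse a) = ?k (inverse u) / u^2"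
        using u False by (simp add: divide_simps power2_eq_square) (simp add: algebra_simps)
    qed
  qed
  hence "contour_integral ?C ?k = 2 * of_real pi * \<i> * reflected_weight H a"
    by (subst contour_integral_unit_circle_inverse) (rule contour_integral_unique)
  thus ?thesis using int by (metis has_contour_integral_integral)
qed

text \<open>P'/P is the sum of 1/(z - a) over the roots with multiplicity, built up by adding one
  root at a time; the leading coefficient cancels.\<close>

lemma has_contour_integral_reflected_log_deriv:
  assumes H: "continuous_on (cball 0 1) H" "H holomorphic_on ball 0 1"
    and P: "P \<noteq> 0" "\<And>z. poly P z = 0 \<Longrightarrow> norm z \<noteq> 1"
  shows "((\<lambda>z. H (inverse z) * (poly (pderiv P) z / poly P z)) has_contour_integral
           2 * of_real pi * \<i> * (\<Sum>a\<in>#proots P. reflected_weight H a)) (circlepath 0 1)"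
proof -
  define Q where "Q = (\<lambda>A. \<Prod>x\<in>#A. [:- x, 1:] :: complex poly)"
  have *: "((\<lambda>z. H (inverse z) * (poly (pderiv (Q A)) z / poly (Q A) z)) has_contour_integral
      2 * of_real pi * \<i> * (\<Sum>a\<in>#A. reflected_weight H a)) (circlepath 0 1)"
    if "\<And>a. a \<in># A \<Longrightarrow> norm a \<noteq> 1" for A
    using that
  proof (induction A)
    case empty
    show ?case using has_contour_integral_0 by (simp add: Q_def pderiv_1)
  next
    case (add x A)
    have IH: "((\<lambda>z. H (inverse z) * (poly (pderiv (Q A)) z / poly (Q A) z)) has_contour_integral
      2 * of_real pi * \<i> * (\<Sum>a\<in>#A. reflected_weight H a)) (circlepath 0 1)"
      using add by auto
    have x: "norm x \<noteq> 1" using add.prems by auto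
    have sum: "2 * of_real pi * \<i> * (\<Sum>a\<in>#add_mset x A. reflected_weight H a) =
        2 * of_real pi * \<i> * (\<Sum>a\<in>#A. reflected_weight H a) + 2 * of_real pi * \<i> * reflected_weight H x"
      by (simp add: algebra_simps)
    show ?case unfolding sum
    proof (rule has_contour_integral_eq[OF has_contour_integral_add[OF IH
          has_contour_integral_reflected_Cauchy[OF H x]]])
      fix z assume "z \<in> path_image (circlepath 0 (1::real))"
      hence z: "norm z = 1" by auto
      have zx: "z - x \<noteq> 0" using x z by auto
      have "poly (Q A) z = (\<Prod>x\<in>#A. z - x)"
        by (induction A) (auto simp: Q_def algebra_simps)
      hence QA: "poly (Q A) z \<noteq> 0" using z add.prems by (auto simp: prod_mset_zero_iff)
      have Q: "Q (add_mset x A) = [:- x, 1:] * Q A" by (simp add: Q_def)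
      have "poly (pderiv (Q (add_mset x A))) z = poly (Q A) z + (z - x) * poly (pderiv (Q A)) z"
        unfolding Q pderiv_mult by (simp add: pderiv_pCons algebra_simps)
      moreover have "poly (Q (add_mset x A)) z = (z - x) * poly (Q A) z"
        unfolding Q by (simp add: algebra_simps)
      ultimately show "H (inverse z) * (poly (pderiv (Q A)) z / poly (Q A) z) + H (inverse z) / (z - x) =
          H (inverse z) * (poly (pderiv (Q (add_mset x A))) z / poly (Q (add_mset x A)) z)"
        using zx QA by (simp add: divide_simps) (simp add: algebra_simps)
    qed
  qed
  have Peq: "P = smult (lead_coeff P) (Q (proots P))"
    unfolding Q_def by (rule complex_poly_decompose_multiset[symmetric])
  have "poly (pderiv P) z / poly P z = poly (pderiv (Q (proots P))) z / poly (Q (proots P)) z" for z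
    using P(1) by (subst (1 2) Peq) (simp add: pderiv_smult)
  moreover have "norm a \<noteq> 1" if "a \<in># proots P" for a using that P by simp
  ultimately show ?thesis using *[of "proots P"] by simp
qed

subsection \<open>The conformal map\<close>

lemma sum_mset_if:
  fixes c :: "'a :: comm_semiring_1"
  shows "(\<Sum>a\<in>#M. if C a then c else 0) = c * of_nat (size (filter_mset C M))"
  by (induction M) (auto simp: algebra_simps)

text \<open>One neighbourhood of the closed disk, as provided by \<open>R_domain_param\<close>, is
  fixed as \<open>U\<close> and shared by all lemmas.\<close>

locale R_domain =
  fixes p q :: "complex poly" and U :: "complex set"
  assumes coprime: "coprime p q"
    and U: "open U" "cball 0 1 \<subseteq> U"
    and q_nz: "\<And>z. z \<in> U \<Longrightarrow> poly q z \<noteq> 0"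
    and inj: "inj_on (rat_fun p q) U"
begin

abbreviation "\<phi> \<equiv> rat_fun p q"
abbreviation "\<Omega> \<equiv> \<phi> ` ball 0 1"

lemma in_U: "norm z \<le> 1 \<Longrightarrow> z \<in> U"
  using U by auto

lemma ball_subset_U: "ball 0 1 \<subseteq> U"
  using in_U by auto

lemma phi_has_derivative:
  assumes "poly q z \<noteq> 0"
  shows "(\<phi> has_field_derivative
    (poly (pderiv p) z * poly q z - poly p z * poly (pderiv q) z) / (poly q z)^2) (at z)"
  unfolding rat_fun_def using assms
  by (auto intro!: derivative_eq_intros simp: power2_eq_square)

lemma phi_holomorphic: "\<phi> holomorphic_on U"
  unfolding rat_fun_def by (intro holomorphic_intros ballI q_nz)

lemma phi_continuous: "continuous_on U \<phi>"
  using phi_holomorphic by (rule holomorphic_on_imp_continuous_on)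

lemma open_Omega: "open \<Omega>"
proof (rule open_mapping_thm3)
  show "\<phi> holomorphic_on ball 0 1" using phi_holomorphic ball_subset_U by (rule holomorphic_on_subset)
  show "inj_on \<phi> (ball 0 1)" using inj ball_subset_U by (rule inj_on_subset)
qed auto

lemma compact_image_cball: "compact (\<phi> ` cball 0 1)"
  using phi_continuous U by (intro compact_continuous_image) (auto intro: continuous_on_subset)

lemma closure_Omega: "closure \<Omega> = \<phi> ` cball 0 1"
proof
  show "closure \<Omega> \<subseteq> \<phi> ` cball 0 1"
    using compact_image_cball by (intro closure_minimal) (auto simp: compact_imp_closed)
  have "\<phi> ` closure (ball 0 1) \<subseteq> closure \<Omega>"
    using phi_continuous U
    by (intro image_closure_subset) (auto intro: continuous_on_subset closure_subset[THEN subsetD])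
  thus "\<phi> ` cball 0 1 \<subseteq> closure \<Omega>" by simp
qed

lemma phi_notin_Omega: "z \<in> U \<Longrightarrow> norm z \<ge> 1 \<Longrightarrow> \<phi> z \<notin> \<Omega>"
  using inj U by (force dest: inj_onD)

lemma phi_notin_closure_Omega: "z \<in> U \<Longrightarrow> norm z > 1 \<Longrightarrow> \<phi> z \<notin> closure \<Omega>"
  unfolding closure_Omega using inj U by (force dest: inj_onD)

lemma phi_in_frontier: "norm z = 1 \<Longrightarrow> \<phi> z \<in> frontier \<Omega>"
  using phi_notin_Omega[OF in_U] open_Omega
  by (auto simp: frontier_def interior_open closure_Omega)

lemma bounded_Omega: "bounded \<Omega>"
  using compact_image_cball by (meson ball_subset_cball bounded_subset compact_imp_bounded image_mono)

section \<open>Contour integrals on circles around the disk\<close>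

lemma annulus_in_U: obtains R where "R > 1" "cball 0 R \<subseteq> U"
proof -
  obtain e where e: "e > 0" "(\<Union>x\<in>cball 0 1. cball x e) \<subseteq> U"
    using compact_subset_open_imp_cball_epsilon_subset[OF compact_cball U] by blast
  have "cball 0 (1 + e) \<subseteq> U"
  proof
    fix z :: complex assume z: "z \<in> cball 0 (1 + e)"
    show "z \<in> U"
    proof (cases "norm z \<le> 1")
      case False
      hence "z \<noteq> 0" by auto
      \<comment> \<open>The radial projection \<open>sgn z\<close> is a point of the closed disk at
        distance \<open>norm z - 1\<close>, hence at most \<open>e\<close>, from
        \<open>z\<close>.\<close>
      hence "z - sgn z = (norm z - 1) *\<^sub>R sgn z" 
        by (simp add: sgn_div_norm left_diff_distrib scaleR_diff_left)
      hence "dist z (sgn z) = norm z - 1" using False \<open>z \<noteq> 0\<close> by (simp add: dist_norm norm_sgn)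
      hence "z \<in> cball (sgn z) e" using z by (simp add: dist_commute)
      moreover have "sgn z \<in> cball 0 1" using False by (auto simp: norm_sgn)
      ultimately show ?thesis using e by blast
    qed (use U in auto)
  qed
  thus ?thesis using e that[of "1 + e"] by auto
qed

text \<open>The integral over \<open>|z| = s\<close> vanishes for \<open>s > 1\<close> because \<open>\<phi>\<close> carries the circle to a loop
  in the exterior domain; let \<open>s\<close> tend to 1.\<close>
lemma contour_integral_phi_eq_0:
  assumes w: "w \<in> \<Omega>"
    and g: "g holomorphic_on - closure \<Omega>" "continuous_on (- \<Omega>) g" "(g \<longlongrightarrow> 0) at_infinity"
  shows "contour_integral (circlepath 0 1) (\<lambda>z. deriv \<phi> z * (g (\<phi> z) / (\<phi> z - w))) = 0"
proof -
  obtain R where R: "R > 1" "cball 0 R \<subseteq> U" by (rule annulus_in_U)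
  define E where "E = (\<lambda>z. deriv \<phi> z * (g (\<phi> z) / (\<phi> z - w)))"
  define I where "I = (\<lambda>s. contour_integral (circlepath 0 s) E)"
  obtain zw where zw: "zw \<in> ball 0 1" "w = \<phi> zw" using w by blast
  have I0: "I s = 0" if s: "s \<in> {1<..<R}" for s
  proof -
    let ?\<gamma> = "\<phi> \<circ> circlepath 0 s"
    have sU: "path_image (circlepath 0 s) \<subseteq> U" using s R by auto
    have "contour_integral ?\<gamma> (\<lambda>\<zeta>. g \<zeta> / (\<zeta> - w)) = 0"
    proof (rule Cauchy_theorem_exterior[where K = "closure \<Omega>"])
      show "compact (closure \<Omega>)" using bounded_Omega by simp
      show "w islimpt closure \<Omega>"
        using w open_Omega by (meson closure_subset interiorI interior_limit_point islimpt_subset)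
      \<comment> \<open>A disk minus one point is connected, and injectivity lets \<phi> carry it
        exactly onto the closure minus \<open>w\<close>.\<close>
      have "connected (cball 0 1 - {zw})"
        by (rule connected_punctured_convex) (auto simp: aff_dim_cball)
      moreover have "closure \<Omega> - {w} = \<phi> ` (cball 0 1 - {zw})"
        using inj U zw by (force simp: closure_Omega dest: inj_onD)
      moreover have "continuous_on (cball 0 1 - {zw}) \<phi>"
        using phi_continuous U by (auto intro: continuous_on_subset)
      ultimately show "connected (closure \<Omega> - {w})" by (simp add: connected_continuous_image)
      show "valid_path ?\<gamma>"
        using valid_path_compose_holomorphic[OF valid_path_circlepath phi_holomorphic U(1) sU] .
      show "pathfinish ?\<gamma> = pathstart ?\<gamma>"
        by (simp add: pathfinish_compose pathstart_compose)
      have "z \<in> U \<and> norm z > 1" if "z \<in> sphere 0 s" for z using that s R by auto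
      thus "path_image ?\<gamma> \<subseteq> - closure \<Omega>"
        using s phi_notin_closure_Omega by (auto simp: path_image_compose)
    qed (use g in auto)
    also have "contour_integral ?\<gamma> (\<lambda>\<zeta>. g \<zeta> / (\<zeta> - w)) = I s"
      unfolding I_def E_def using phi_holomorphic U(1) sU
      by (intro contour_integral_comp_analyticW[where s = U]) (auto simp: analytic_on_open)
    finally show ?thesis .
  qed
  let ?A = "{z. 1 \<le> norm z \<and> norm z \<le> R}"
  have AU: "?A \<subseteq> U" using R by auto
  have nO: "\<phi> z \<notin> \<Omega>" if "z \<in> ?A" for z
    using that AU by (intro phi_notin_Omega) auto
  have E: "continuous_on ?A E"
    unfolding E_def
  proof (intro continuous_intros)
    show "continuous_on ?A (deriv \<phi>)"
      using holomorphic_deriv[OF phi_holomorphic U(1)] AU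
      by (meson continuous_on_subset holomorphic_on_imp_continuous_on)
    show c: "continuous_on ?A \<phi>" using phi_continuous AU by (rule continuous_on_subset)
    show "continuous_on ?A (\<lambda>z. g (\<phi> z))"
      by (rule continuous_on_compose2[OF g(2) c]) (intro image_subsetI, simp only: nO Compl_iff not_False_eq_True)
    show "\<forall>z\<in>?A. \<phi> z - w \<noteq> 0" using nO w by (metis right_minus_eq)
  qed
  define ex where "ex = (\<lambda>t. exp (2 * of_real pi * \<i> * of_real t))"
  have ex: "continuous_on S ex" for S unfolding ex_def by (intro continuous_intros)
  have nex: "norm (ex t) = 1" for t by (simp add: ex_def)
  have I: "I = (\<lambda>s. integral (cbox 0 1) (\<lambda>t. E (of_real s * ex t) * (of_real (2 * pi) * \<i> * of_real s * ex t)))"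
    unfolding I_def contour_integral_integral vector_derivative_circlepath
    by (simp add: circlepath ex_def)
  \<comment> \<open>\<open>E\<close> is continuous on the closed annulus, including the unit circle,
    so the parametrised integrand is jointly continuous in radius and parameter.\<close>
  have "continuous_on {1..R} I"
    unfolding I
  proof (rule integral_continuous_on_param)
    have "continuous_on ({1..R} \<times> cbox 0 1) (\<lambda>x. E (of_real (fst x) * ex (snd x)))"
      by (intro continuous_on_compose2[OF E] continuous_intros continuous_on_compose2[OF ex[of UNIV]])
         (auto simp: norm_mult nex)
    moreover have "continuous_on ({1..R} \<times> cbox 0 1) (\<lambda>x. ex (snd x))"
      by (intro continuous_on_compose2[OF ex[of UNIV]] continuous_intros) auto
    ultimately show "continuous_on ({1..R} \<times> cbox 0 1)
        (\<lambda>(s, t). E (of_real s * ex t) * (of_real (2 * pi) * \<i> * of_real s * ex t))"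
      unfolding case_prod_unfold by (intro continuous_intros)
  qed
  hence "I 1 = 0"
    using R I0 by (intro continuous_constant_on_closure[of "{1<..<R}" I 0 1]) auto
  thus ?thesis by (simp add: I_def E_def)
qed

section \<open>Sums over the roots and values of the reflection\<close>

text \<open>With \<open>P = p - smult w q\<close> one has \<phi>'/(\<phi> - w) = P'/P - q'/q.
  Neither polynomial vanishes on the unit circle, so both logarithmic derivatives can be integrated
  against \<open>H (1/z)\<close>, and the difference is the vanishing integral. The
  \<open>H 0\<close> terms account for a solution or a pole at infinity.\<close>

lemma root_weight_sum:
  assumes w: "w \<in> \<Omega>"
    and g: "g holomorphic_on - closure \<Omega>" "continuous_on (- \<Omega>) g" "(g \<longlongrightarrow> 0) at_infinity"
    and H: "continuous_on (cball 0 1) H" "H holomorphic_on ball 0 1"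
    and Hg: "\<And>z. norm z = 1 \<Longrightarrow> H (inverse z) = g (\<phi> z)"
  shows "(\<Sum>a\<in>#proots (p - smult w q). reflected_weight H a) = (\<Sum>b\<in>#proots q. reflected_weight H b)"
proof -
  define P where "P = p - smult w q"
  have sU: "z \<in> U" if "norm z = 1" for z using U that by auto
  have Pq: "poly P z \<noteq> 0" "poly q z \<noteq> 0" if "norm z = 1" for z
  proof -
    show "poly q z \<noteq> 0" using q_nz sU[OF that] by auto
    moreover have "\<phi> z \<noteq> w" using phi_notin_Omega[OF sU[OF that]] that w by auto
    ultimately show "poly P z \<noteq> 0" by (auto simp: P_def rat_fun_def field_simps)
  qed
  have nz: "P \<noteq> 0" "q \<noteq> 0" using Pq[of 1] by auto
  let ?L = "\<lambda>P z. H (inverse z) * (poly (pderiv P) z / poly P z)"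
  have "((\<lambda>z. ?L P z - ?L q z) has_contour_integral
      2 * of_real pi * \<i> * (\<Sum>a\<in>#proots P. reflected_weight H a) -
      2 * of_real pi * \<i> * (\<Sum>b\<in>#proots q. reflected_weight H b)) (circlepath 0 1)"
    using Pq nz by (intro has_contour_integral_diff has_contour_integral_reflected_log_deriv H) blast+
  moreover have "contour_integral (circlepath 0 1) (\<lambda>z. ?L P z - ?L q z) =
      contour_integral (circlepath 0 1) (\<lambda>z. deriv \<phi> z * (g (\<phi> z) / (\<phi> z - w)))"
  proof (rule contour_integral_eq)
    fix z assume "z \<in> path_image (circlepath 0 (1::real))"
    hence z: "norm z = 1" by simp
    have d: "deriv \<phi> z = (poly (pderiv p) z * poly q z - poly p z * poly (pderiv q) z) / (poly q z)^2"
      using Pq(2)[OF z] by (intro DERIV_imp_deriv phi_has_derivative)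
    have w': "\<phi> z - w = poly P z / poly q z"
      using Pq(2)[OF z] by (simp add: rat_fun_def P_def field_simps)
    have P': "poly (pderiv P) z = poly (pderiv p) z - w * poly (pderiv q) z"
      "poly P z = poly p z - w * poly q z"
      by (simp_all add: P_def pderiv_diff pderiv_smult)
    show "?L P z - ?L q z = deriv \<phi> z * (g (\<phi> z) / (\<phi> z - w))"
      unfolding d w' Hg[OF z, symmetric] using Pq[OF z]
      by (simp add: divide_simps power2_eq_square) (simp add: P' algebra_simps)
  qed
  ultimately have "2 * of_real pi * \<i> * (\<Sum>a\<in>#proots P. reflected_weight H a) -
      2 * of_real pi * \<i> * (\<Sum>b\<in>#proots q. reflected_weight H b) = 0"
    using contour_integral_phi_eq_0[OF w g] by (simp add: contour_integral_unique)
  thus ?thesis by (simp add: P_def)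
qed

text \<open>\<open>root_weight_sum\<close> also applies to \<open>poly S \<circ> H\<close> and \<open>poly S \<circ> g\<close> whenever \<open>S\<close> vanishes at 0;
  a suitable \<open>S\<close> isolates a single value of \<open>H\<close>.\<close>
lemma reflected_values_finite:
  assumes w: "w \<in> \<Omega>"
    and g: "g holomorphic_on - closure \<Omega>" "continuous_on (- \<Omega>) g" "(g \<longlongrightarrow> 0) at_infinity"
    and H: "continuous_on (cball 0 1) H" "H holomorphic_on ball 0 1"
    and Hg: "\<And>z. norm z = 1 \<Longrightarrow> H (inverse z) = g (\<phi> z)"
    and z: "norm z > 1" "poly (p - smult w q) z = 0"
  shows "H (inverse z) \<in> {0, H 0} \<union> (\<lambda>b. H (inverse b)) ` set_mset (proots q)" (is "?v \<in> ?Z")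
proof (rule ccontr)
  assume nv: "?v \<notin> ?Z"
  define P where "P = p - smult w q"
  have P0: "P \<noteq> 0"
  proof
    assume "P = 0"
    hence "poly P 1 = 0" by simp
    hence "\<phi> 1 = w" using q_nz[OF in_U, of 1] by (auto simp: P_def rat_fun_def field_simps)
    thus False using phi_notin_Omega[OF in_U, of 1] w by auto
  qed
  \<comment> \<open>\<open>S\<close> is to vanish at every value that can occur in either sum,
    except \<open>?v\<close>. Since 0 is in \<open>?Z\<close>, also \<open>poly S 0 = 0\<close>,
    which gives the decay of \<open>S\<close> composed with \<open>g\<close>.\<close>
  define Y where "Y = ?Z \<union> (\<lambda>a. H (inverse a)) ` set_mset (proots P) - {?v}"
  define S where "S = (\<Prod>y\<in>Y. [:- y, 1:])"
  have "finite Y" by (simp add: Y_def)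
  hence S0: "poly S x = 0 \<longleftrightarrow> x \<in> Y" for x by (auto simp: S_def poly_prod)
  have Z: "poly S x = 0" if "x \<in> ?Z" for x using that nv unfolding S0 Y_def by blast
  have S_root: "poly S (H (inverse a)) = 0" if "a \<in># proots P" "H (inverse a) \<noteq> ?v" for a
    using that unfolding S0 Y_def by blast
  have sum: "(\<Sum>a\<in>#proots P. reflected_weight (\<lambda>u. poly S (H u)) a) =
      (\<Sum>b\<in>#proots q. reflected_weight (\<lambda>u. poly S (H u)) b)"
    unfolding P_def
  proof (rule root_weight_sum[OF w])
    show "(\<lambda>\<zeta>. poly S (g \<zeta>)) holomorphic_on - closure \<Omega>" "continuous_on (- \<Omega>) (\<lambda>\<zeta>. poly S (g \<zeta>))"
      "continuous_on (cball 0 1) (\<lambda>u. poly S (H u))" "(\<lambda>u. poly S (H u)) holomorphic_on ball 0 1"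
      using g H by (auto intro!: holomorphic_intros continuous_intros)
    show "((\<lambda>\<zeta>. poly S (g \<zeta>)) \<longlongrightarrow> 0) at_infinity"
      using tendsto_poly[OF g(3), of S] Z[of 0] by simp
  qed (simp add: Hg)
  have "(\<Sum>b\<in>#proots q. reflected_weight (\<lambda>u. poly S (H u)) b) = 0"
    by (rule sum_mset.neutral) (auto simp: reflected_weight_def Z)
  also note sum[symmetric]
  \<comment> \<open>Only outer roots with value \<open>?v\<close> survive, and all contribute the
    same nonzero number, so nothing can cancel and their count is 0.\<close>
  also have "(\<Sum>a\<in>#proots P. reflected_weight (\<lambda>u. poly S (H u)) a) =
      (\<Sum>a\<in>#proots P. if norm a > 1 \<and> H (inverse a) = ?v then - poly S ?v else 0)"
    using Z[of "H 0"] S_root by (intro arg_cong[where f = sum_mset] image_mset_cong)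
      (auto simp: reflected_weight_def)
  also have "\<dots> = - poly S ?v * of_nat (size (filter_mset (\<lambda>a. norm a > 1 \<and> H (inverse a) = ?v) (proots P)))"
    by (rule sum_mset_if)
  finally have "size (filter_mset (\<lambda>a. norm a > 1 \<and> H (inverse a) = ?v) (proots P)) = 0"
    using S0[of ?v] by (auto simp: Y_def)
  moreover have "z \<in># filter_mset (\<lambda>a. norm a > 1 \<and> H (inverse a) = ?v) (proots P)"
    using z P0 by (simp add: P_def)
  ultimately show False by (metis empty_iff set_mset_empty size_eq_0_iff_empty)
qed

section \<open>Solutions outside the disk and constancy of the reflection\<close>

text \<open>Choose \<open>w\<close> such that \<open>p - smult w q\<close> has full degree, at least
  2. If all roots were in the closed disk, injectivity would merge them into one multiple root,
  where \<phi>' vanishes, contrary to univalence.\<close>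

lemma exterior_preimage:
  assumes "rat_degree p q \<ge> 2"
  obtains w z where "w \<in> \<Omega>" "norm z > 1" "poly (p - smult w q) z = 0"
proof -
  define n where "n = rat_degree p q"
  have n: "n \<ge> 2" "degree p \<le> n" "degree q \<le> n" using assms by (auto simp: n_def rat_degree_def)
  have "coeff p n \<noteq> 0 \<or> coeff q n \<noteq> 0"
    using assms by (auto simp: n_def rat_degree_def max_def)
  \<comment> \<open>The coefficient of degree \<open>n\<close> drops out for at most one
    \<open>w\<close>, whereas \<Omega> is infinite.\<close>
  hence fin: "finite {w. coeff p n - w * coeff q n = 0}"
  proof (cases "coeff q n = 0")
    case False
    hence "{w. coeff p n - w * coeff q n = 0} \<subseteq> {coeff p n / coeff q n}" by (auto simp: field_simps)
    thus ?thesis using finite_subset by blast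
  qed auto
  have "infinite \<Omega>"
    using open_Omega by (meson ball_eq_empty finite_imp_not_open image_is_empty linorder_not_less zero_less_one)
  hence "\<not> \<Omega> \<subseteq> {w. coeff p n - w * coeff q n = 0}" using fin finite_subset by blast
  then obtain w where w: "w \<in> \<Omega>" "coeff p n - w * coeff q n \<noteq> 0" by blast
  define P where "P = p - smult w q"
  have "coeff P n \<noteq> 0" using w by (simp add: P_def)
  hence deg: "degree P \<ge> 2" using le_degree[of P n] n by auto
  hence P0: "P \<noteq> 0" by auto
  obtain zw where zw: "zw \<in> ball 0 1" "w = \<phi> zw" using w by blast
  have zwU: "zw \<in> U" using zw U by auto
  have "\<exists>z. norm z > 1 \<and> poly P z = 0"
  proof (rule ccontr)
    assume "\<nexists>z. norm z > 1 \<and> poly P z = 0"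
    hence le1: "norm z \<le> 1" if "poly P z = 0" for z using that by force
    have "z = zw" if "poly P z = 0" for z
    proof -
      have zU: "z \<in> U" using le1[OF that] by (rule in_U)
      hence "\<phi> z = \<phi> zw" using that q_nz[OF zU] zw(2) by (auto simp: P_def rat_fun_def field_simps)
      thus ?thesis using inj zU zwU by (auto dest: inj_onD)
    qed
    hence "set_mset (proots P) \<subseteq> {zw}" using P0 by auto
    hence rep: "proots P = replicate_mset (size (proots P)) zw"
      by (metis set_mset_subset_singletonD size_replicate_mset)
    have sz: "size (proots P) = degree P" by (rule size_proots_complex)
    define l where "l = lead_coeff P"
    have *: "P = smult l ([:- zw, 1:] ^ degree P)"
      using complex_poly_decompose_multiset[of P] unfolding l_def[symmetric]
      by (subst (asm) rep) (simp add: sz)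
    obtain k where k: "degree P = Suc (Suc k)"
      using deg by (metis add_2_eq_Suc le_Suc_ex)
    have Pk: "P = [:- zw, 1:] * ([:- zw, 1:] * smult l ([:- zw, 1:] ^ k))"
      using * unfolding k power_Suc mult_smult_right .
    have "poly (pderiv P) zw = 0"
      unfolding Pk pderiv_mult poly_add poly_mult by simp
    moreover have "poly P zw = 0" by (subst Pk) simp
    ultimately have "poly (pderiv p) zw * poly q zw - poly p zw * poly (pderiv q) zw = 0"
      by (simp add: P_def pderiv_diff pderiv_smult)
    hence "deriv \<phi> zw = 0"
      using DERIV_imp_deriv[OF phi_has_derivative[OF q_nz[OF zwU]]] by simp
    thus False using holomorphic_injective_imp_regular[OF phi_holomorphic U(1) inj zwU] by simp
  qed
  thus ?thesis using that w by (auto simp: P_def)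
qed

text \<open>Near the reciprocal of an outer solution all points still map into \<Omega>, so
  \<open>H\<close> takes finitely many values there. By continuity it is constant on a small ball,
  and by the identity theorem on the disk.\<close>

lemma reflected_constant:
  assumes deg: "rat_degree p q \<ge> 2"
    and g: "g holomorphic_on - closure \<Omega>" "continuous_on (- \<Omega>) g" "(g \<longlongrightarrow> 0) at_infinity"
    and H: "continuous_on (cball 0 1) H" "H holomorphic_on ball 0 1"
    and Hg: "\<And>z. norm z = 1 \<Longrightarrow> H (inverse z) = g (\<phi> z)"
  obtains \<kappa> where "\<And>u. norm u < 1 \<Longrightarrow> H u = \<kappa>"
proof -
  obtain w z where wz: "w \<in> \<Omega>" "norm z > 1" "poly (p - smult w q) z = 0"
    using exterior_preimage[OF deg] by blast
  \<comment> \<open>A common zero of \<open>p - smult w q\<close> and \<open>q\<close> would be a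
    zero of \<open>p\<close> too, against coprimality; so \<open>z\<close> is not a pole.\<close>
  have qz: "poly q z \<noteq> 0"
    using wz(3) coprime_poly_0[OF coprime, of z] by auto
  have phiz: "\<phi> z = w" using wz(3) qz by (simp add: rat_fun_def field_simps)
  define D where "D = {u. u \<noteq> 0 \<and> poly q (inverse u) \<noteq> 0}"
  define E where "E = D \<inter> (\<lambda>u. \<phi> (inverse u)) -` \<Omega> \<inter> ball 0 1"
  have D_eq: "D = - {0} \<inter> (\<lambda>u. poly q (inverse u)) -` (- {0})" by (auto simp: D_def)
  have "open D" unfolding D_eq
    by (intro continuous_open_preimage continuous_intros open_Compl) auto
  moreover have "continuous_on D (\<lambda>u. \<phi> (inverse u))"
    unfolding rat_fun_def D_def by (intro continuous_intros) auto
  ultimately have "open E" unfolding E_def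
    by (intro open_Int continuous_open_preimage open_Omega) auto
  moreover have zE: "inverse z \<in> E"
    using wz qz phiz by (auto simp: E_def D_def norm_inverse inverse_less_1_iff)
  ultimately obtain e where e: "e > 0" "ball (inverse z) e \<subseteq> E" by (meson openE)
  define Z where "Z = {0, H 0} \<union> (\<lambda>b. H (inverse b)) ` set_mset (proots q)"
  have "H u \<in> Z" if "u \<in> E" for u
  proof -
    have u: "u \<noteq> 0" "poly q (inverse u) \<noteq> 0" "\<phi> (inverse u) \<in> \<Omega>" "norm u < 1"
      using that by (auto simp: E_def D_def)
    have "H (inverse (inverse u)) \<in> Z" unfolding Z_def
      by (rule reflected_values_finite[OF u(3) g H Hg])
         (use u in \<open>auto simp: norm_inverse one_less_inverse rat_fun_def\<close>)
    thus ?thesis by simp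
  qed
  hence "H ` ball (inverse z) e \<subseteq> Z" using e by blast
  moreover have "finite Z" by (simp add: Z_def)
  ultimately have "finite (H ` ball (inverse z) e)" using finite_subset by blast
  moreover have sub: "ball (inverse z) e \<subseteq> ball 0 1" using e by (auto simp: E_def)
  hence "continuous_on (ball (inverse z) e) H"
    using H(1) ball_subset_cball continuous_on_subset by blast
  ultimately have "H constant_on ball (inverse z) e"
    by (intro continuous_finite_range_constant) auto
  then obtain \<kappa> where \<kappa>: "H u = \<kappa>" if "u \<in> ball (inverse z) e" for u
    unfolding constant_on_def by blast
  have "H u = \<kappa>" if "norm u < 1" for u
    by (rule analytic_continuation_open[of "ball (inverse z) e" "ball 0 1" H "\<lambda>_. \<kappa>"])
       (use e sub H \<kappa> that in auto)
  thus ?thesis using that by blast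
qed

text \<open>On the unit circle conjugation equals inversion, which turns the matching condition into
  \<open>H (1/z) = g (\<phi> z)\<close>. Constancy of \<open>H\<close> makes \<open>f\<close>
  constant up to the boundary, hence \<open>g\<close> constant on the boundary, and the zero at
  infinity makes this constant 0.\<close>

lemma matching_solution_trivial:
  assumes deg: "rat_degree p q \<ge> 2" and fg: "matching_solution \<Omega> f g"
  shows "z \<in> closure \<Omega> \<Longrightarrow> f z = 0" and "z \<notin> \<Omega> \<Longrightarrow> g z = 0"
proof -
  have f: "f holomorphic_on \<Omega>" "continuous_on (closure \<Omega>) f"
    and g: "g holomorphic_on - closure \<Omega>" "continuous_on (- \<Omega>) g" "(g \<longlongrightarrow> 0) at_infinity"
    and eq: "\<And>\<zeta>. \<zeta> \<in> frontier \<Omega> \<Longrightarrow> f \<zeta> = cnj (g \<zeta>)"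
    using fg by (auto simp: matching_solution_def)
  define H where "H = cnj \<circ> (f \<circ> \<phi>) \<circ> cnj"
  have cont: "continuous_on (cball 0 1) (f \<circ> \<phi>)"
    using phi_continuous U f(2)
    by (intro continuous_on_compose) (auto simp: closure_Omega intro: continuous_on_subset)
  have "continuous_on (cball 0 1) (\<lambda>u. (f \<circ> \<phi>) (cnj u))"
    by (intro continuous_on_compose2[OF cont] continuous_intros) auto
  hence Hc: "continuous_on (cball 0 1) H"
    unfolding H_def o_def by (intro continuous_intros)
  have "cnj ` ball 0 1 = ball 0 1"
    by (auto intro!: image_eqI[of _ cnj "cnj _"])
  moreover have "f \<circ> \<phi> holomorphic_on ball 0 1"
    using holomorphic_on_subset[OF phi_holomorphic ball_subset_U] f(1)
    by (rule holomorphic_on_compose)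
  ultimately have Hh: "H holomorphic_on ball 0 1"
    unfolding H_def by (intro holomorphic_on_compose_cnj_cnj) auto
  have Hg: "H (inverse z) = g (\<phi> z)" if "norm z = 1" for z
  proof -
    have "cnj (inverse z) = z" using that
      by (metis complex_cnj_cnj complex_cnj_inverse inverse_inverse_eq divide_conv_cnj inverse_eq_divide mult_1)
    thus ?thesis using eq[OF phi_in_frontier[OF that]] by (simp add: H_def)
  qed
  obtain \<kappa> where \<kappa>: "\<And>u. norm u < 1 \<Longrightarrow> H u = \<kappa>"
    using reflected_constant[OF deg g Hc Hh Hg] by blast
  have "f \<zeta> = cnj \<kappa>" if "\<zeta> \<in> \<Omega>" for \<zeta>
  proof -
    obtain z where "z \<in> ball 0 1" "\<zeta> = \<phi> z" using \<open>\<zeta> \<in> \<Omega>\<close> by blast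
    thus ?thesis using \<kappa>[of "cnj z"] by (auto simp: H_def)
  qed
  hence fc: "f \<zeta> = cnj \<kappa>" if "\<zeta> \<in> closure \<Omega>" for \<zeta>
    using continuous_constant_on_closure[OF f(2)] that by blast
  have gc: "g \<zeta> = \<kappa>" if "\<zeta> \<in> frontier \<Omega>" for \<zeta>
    using eq[OF that] fc[of \<zeta>] that by (simp add: frontier_def)
  have 0: "\<phi> 0 \<in> \<Omega>" by simp
  note zero = exterior_constant_boundary_imp_zero[OF bounded_Omega open_Omega 0 g gc]
  show "g z = 0" if "z \<notin> \<Omega>" using zero(2) that by blast
  show "f z = 0" if "z \<in> closure \<Omega>" using zero(1) fc that by simp
qed

end

theorem theorem3p19:
  fixes p q :: "complex poly" and f g :: "complex \<Rightarrow> complex"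
  assumes "R_domain_param p q"
    and "rat_degree p q \<ge> 2"
    and "matching_solution (rat_fun p q ` ball 0 1) f g"
  shows "(\<forall>z\<in>closure (rat_fun p q ` ball 0 1). f z = 0) \<and> (\<forall>z\<in>- (rat_fun p q ` ball 0 1). g z = 0)"
proof -
  from assms(1) obtain U where "R_domain p q U"
    unfolding R_domain_param_def R_domain_def by blast
  then interpret R_domain p q U .
  show ?thesis using matching_solution_trivial[OF assms(2,3)] by blast
qed

end
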